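(* Let $U^{(1)},\dots,U^{(r)}$ be unitary matrices of sizes $n_1\times n_1,\dots,n_r\times n_r$. Then the generalized defect is supermultiplicative: $$\mathbf{D}\big(U^{(1)}\otimes\cdots\otimes U^{(r)}\big)\ \ge\ \mathbf{D}(U^{(1)})\cdots\mathbf{D}(U^{(r)}).$$
   Context: For a unitary $N\times N$ matrix $U$ and $1\le i<j\le N$ let $M_U^{(i,j)}$ be the complex $N\times N$ matrix whose $i$-th row has entries $U_{i,c}\overline{U_{j,c}}$ ($c=1,\dots,N$), whose $j$-th row has entries $-U_{i,c}\overline{U_{j,c}}$, and whose other rows are zero. Let $A_U^{(i,j)}$ and $S_U^{(i,j)}$ be its entrywise real and imaginary parts. Let $\mathbb{M}_U$ be the real linear span, inside the space of real $N\times N$ matrices, of all $A_U^{(i,j)},S_U^{(i,j)}$, $1\le i<j\le N$. The generalized defect of $U$ is $\mathbf{D}(U)=N^2-\dim_{\mathbb{R}}\mathbb{M}_U$, i.e. the dimension of the orthogonal complement of $\mathbb{M}_U$ in the space of real $N\times N$ matrices with inner product $\mathrm{tr}(AB^T)$. *)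

theory Defs
  imports "Jordan_Normal_Form.VS_Connect" "Jordan_Normal_Form.Schur_Decomposition"
begin

text \<open>Rows and columns are indexed from 0, following the conventions of the matrix library, so the
  pairs \<open>1 \<le> i < j \<le> N\<close> become \<open>i < j < N\<close>.\<close>

definition unitary_mat :: "complex mat \<Rightarrow> bool" where
  "unitary_mat U \<longleftrightarrow> square_mat U \<and>
     U * mat_adjoint U = 1\<^sub>m (dim_row U) \<and> mat_adjoint U * U = 1\<^sub>m (dim_row U)"

definition kron_mat :: "complex mat \<Rightarrow> complex mat \<Rightarrow> complex mat" where
  "kron_mat A B = mat (dim_row A * dim_row B) (dim_col A * dim_col B)
     (\<lambda>(i, j). A $$ (i div dim_row B, j div dim_col B) * B $$ (i mod dim_row B, j mod dim_col B))"

text \<open>The base case is the \<open>1 \<times> 1\<close> identity matrix, which is neutral for the Kronecker product; the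
  product of a one-element list is thus its only factor.\<close>

definition kron_list :: "complex mat list \<Rightarrow> complex mat" where
  "kron_list As = foldr kron_mat As (1\<^sub>m 1)"

lemma kron_mat_one_right: "kron_mat A (1\<^sub>m 1) = A"
  by (rule eq_matI) (auto simp: kron_mat_def)

lemma kron_list_singleton: "kron_list [A] = A"
  by (simp add: kron_list_def kron_mat_one_right del: One_nat_def)

definition defect_mat :: "complex mat \<Rightarrow> nat \<Rightarrow> nat \<Rightarrow> complex mat" where
  "defect_mat U i j = mat (dim_row U) (dim_row U) (\<lambda>(k, c).
     if k = i then U $$ (i, c) * cnj (U $$ (j, c))
     else if k = j then - (U $$ (i, c) * cnj (U $$ (j, c)))
     else 0)"

definition defect_mat_re :: "complex mat \<Rightarrow> nat \<Rightarrow> nat \<Rightarrow> real mat" where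
  "defect_mat_re U i j = map_mat Re (defect_mat U i j)"

definition defect_mat_im :: "complex mat \<Rightarrow> nat \<Rightarrow> nat \<Rightarrow> real mat" where
  "defect_mat_im U i j = map_mat Im (defect_mat U i j)"

definition defect_span :: "complex mat \<Rightarrow> real mat set" where
  "defect_span U = LinearCombinations.module.span (class_ring :: real ring)
     (module_mat TYPE(real) (dim_row U) (dim_row U))
     ({defect_mat_re U i j | i j. i < j \<and> j < dim_row U} \<union>
      {defect_mat_im U i j | i j. i < j \<and> j < dim_row U})"

text \<open>The generalized defect is integer-valued so that the subtraction is not truncated.\<close>

definition generalized_defect :: "complex mat \<Rightarrow> int" where
  "generalized_defect U = int ((dim_row U)\<^sup>2) -
     int (vectorspace.dim (class_ring :: real ring)
       ((module_mat TYPE(real) (dim_row U) (dim_row U)) \<lparr>carrier := defect_span U\<rparr>))"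

end

theory Submission
  imports Defs
begin

text \<open>The generalized defect of \<open>U\<close> is the dimension of the orthogonal complement of the span of the
  real and imaginary parts of the matrices \<open>M\<close> attached to the pairs \<open>i < j\<close>. A real matrix \<open>R\<close>
  is in that complement exactly when, for all rows \<open>i\<close> and \<open>j\<close>,
  \<open>\<Sum>c. R i c * (U i c * cnj (U j c)) = \<Sum>c. R j c * (U i c * cnj (U j c))\<close>.
  Both sides are multiplicative under the Kronecker product: the sum for \<open>R \<otimes> S\<close> and \<open>U \<otimes> V\<close> at a
  pair of product rows is the sum for \<open>R\<close> and \<open>U\<close> times the sum for \<open>S\<close> and \<open>V\<close>. So if \<open>R\<close> is in
  the complement for \<open>U\<close> and \<open>S\<close> in the one for \<open>V\<close>, then \<open>R \<otimes> S\<close> is in the complement for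
  \<open>U \<otimes> V\<close> (lemma \<open>real_kron_in_defect_perp\<close>).

  To compare dimensions, take orthogonal bases of the two complements. Since
  \<open>\<langle>R \<otimes> S, R' \<otimes> S'\<rangle> = \<langle>R, R'\<rangle> * \<langle>S, S'\<rangle>\<close>, the products of the basis elements are again nonzero and
  pairwise orthogonal, hence there are as many of them as the product of the two dimensions, and the
  complement for \<open>U \<otimes> V\<close> has at least that dimension. An induction over the list of factors
  finishes the proof; it also needs that a defect is nonnegative, since an inequality between
  integers is multiplied by one.

  The linear algebra enters only through two facts, which make the subtraction \<open>N\<^sup>2 - dim\<close> accessible:
  there is an orthogonal family of \<open>D(U)\<close> matrices in the complement
  (\<open>defect_perp_orthogonal_basis\<close>), and no orthogonal family in it is larger
  (\<open>card_le_generalized_defect\<close>). Both rest on extending an orthogonal set inside a subspace to an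
  orthogonal basis of that subspace.\<close>

section \<open>Orthogonal sets of real matrices\<close>

definition mat_inner :: "real mat \<Rightarrow> real mat \<Rightarrow> real" where
  "mat_inner A B = (\<Sum>i<dim_row A. \<Sum>j<dim_col A. A $$ (i, j) * B $$ (i, j))"

lemma mat_inner_commute:
  assumes "A \<in> carrier_mat nr nc" "B \<in> carrier_mat nr nc"
  shows "mat_inner A B = mat_inner B A"
  using assms by (simp add: mat_inner_def mult.commute)

lemma mat_inner_add_left:
  assumes "A \<in> carrier_mat nr nc" "B \<in> carrier_mat nr nc"
  shows "mat_inner (A + B) C = mat_inner A C + mat_inner B C"
  using assms by (simp add: mat_inner_def distrib_right sum.distrib)

lemma mat_inner_smult_left: "mat_inner (a \<cdot>\<^sub>m A) C = a * mat_inner A C"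
  by (simp add: mat_inner_def sum_distrib_left mult.assoc)

lemma mat_inner_zero_left: "mat_inner (0\<^sub>m nr nc) C = 0"
  by (simp add: mat_inner_def)

lemma mat_inner_self_eq_0_iff:
  assumes "A \<in> carrier_mat nr nc"
  shows "mat_inner A A = 0 \<longleftrightarrow> A = 0\<^sub>m nr nc"
proof
  assume "mat_inner A A = 0"
  then have "\<forall>i\<in>{..<nr}. (\<Sum>j<nc. A $$ (i, j) * A $$ (i, j)) = 0"
    using assms unfolding mat_inner_def
    by (subst (asm) sum_nonneg_eq_0_iff) (auto intro!: sum_nonneg)
  then have "\<forall>i<nr. \<forall>j<nc. A $$ (i, j) = 0"
    by (subst (asm) sum_nonneg_eq_0_iff) auto
  then show "A = 0\<^sub>m nr nc" using assms by (intro eq_matI) auto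
qed (simp add: mat_inner_zero_left)

text \<open>Asking \<open>mat_inner A A \<noteq> 0\<close> excludes the zero matrix without naming its dimensions.\<close>

definition orthogonal_mats :: "real mat set \<Rightarrow> bool" where
  "orthogonal_mats X \<longleftrightarrow>
     (\<forall>A\<in>X. mat_inner A A \<noteq> 0) \<and> (\<forall>A\<in>X. \<forall>B\<in>X. A \<noteq> B \<longrightarrow> mat_inner A B = 0)"

lemma orthogonal_mats_inner:
  "orthogonal_mats X \<Longrightarrow> A \<in> X \<Longrightarrow> B \<in> X \<Longrightarrow> mat_inner A B = (if A = B then mat_inner B B else 0)"
  by (auto simp: orthogonal_mats_def)

locale real_mat_space = matrix_vs nr nc "TYPE(real)" for nr nc :: nat
begin

lemma mat_inner_finsum:
  assumes "f \<in> X \<rightarrow> carrier_mat nr nc"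
  shows "mat_inner (finsum V f X) C = (\<Sum>A\<in>X. mat_inner (f A) C)"
  using assms
proof (induction X rule: infinite_finite_induct)
  case (insert A X)
  then have f: "f \<in> X \<rightarrow> carrier_mat nr nc" "f A \<in> carrier_mat nr nc" by auto
  then have "finsum V f X \<in> carrier_mat nr nc" using finsum_closed by blast
  note mat_inner_add_left[OF f(2) this, of C]
  moreover have "finsum V f (insert A X) = f A + finsum V f X"
    using finsum_insert[OF insert.hyps] f by auto
  ultimately show ?case using insert.IH[OF f(1)] insert.hyps by simp
qed (simp_all add: mat_inner_zero_left)

lemma mat_inner_lincomb:
  assumes "X \<subseteq> carrier_mat nr nc"
  shows "mat_inner (lincomb a X) C = (\<Sum>A\<in>X. a A * mat_inner A C)"
proof -
  have "(\<lambda>A. a A \<cdot>\<^sub>m A) \<in> X \<rightarrow> carrier_mat nr nc" using assms by auto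
  from mat_inner_finsum[OF this] show ?thesis
    by (simp add: lincomb_def mat_inner_smult_left)
qed

lemma lincomb_carrier: "X \<subseteq> carrier_mat nr nc \<Longrightarrow> lincomb a X \<in> carrier_mat nr nc"
  by (rule lincomb_closed) auto

text \<open>Pairing a vanishing combination with one member of the set leaves only the coefficient of that
  member, multiplied by a nonzero number.\<close>

lemma orthogonal_mats_lin_indpt:
  assumes X: "X \<subseteq> carrier_mat nr nc" and orth: "orthogonal_mats X"
  shows "lin_indpt X"
proof
  assume "lin_dep X"
  then obtain Y a v where Y: "finite Y" "Y \<subseteq> X" "lincomb a Y = 0\<^sub>m nr nc" "v \<in> Y" "a v \<noteq> 0"
    unfolding lin_dep_def by auto
  have "0 = mat_inner (lincomb a Y) v" by (simp add: Y mat_inner_zero_left)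
  also have "\<dots> = (\<Sum>A\<in>Y. a A * mat_inner A v)" using Y X by (subst mat_inner_lincomb) auto
  also have "\<dots> = (\<Sum>A\<in>Y. if A = v then a v * mat_inner v v else 0)"
  proof (rule sum.cong[OF refl])
    fix A assume "A \<in> Y"
    then show "a A * mat_inner A v = (if A = v then a v * mat_inner v v else 0)"
      using orthogonal_mats_inner[OF orth subsetD[OF Y(2)] subsetD[OF Y(2,4)], of A] by simp
  qed
  also have "\<dots> = a v * mat_inner v v" using Y by simp
  finally show False using Y orth by (auto simp: orthogonal_mats_def)
qed

text \<open>The witness is the orthogonal projection of \<open>A\<close> onto the span of \<open>X\<close>.\<close>

lemma orthogonal_projection:
  assumes X: "X \<subseteq> carrier_mat nr nc" "finite X" and orth: "orthogonal_mats X"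
    and A: "A \<in> carrier_mat nr nc"
  obtains P where "P \<in> span X" "\<And>B. B \<in> X \<Longrightarrow> mat_inner (A + (-1) \<cdot>\<^sub>m P) B = 0"
proof
  let ?P = "lincomb (\<lambda>B. mat_inner A B / mat_inner B B) X"
  show "?P \<in> span X" unfolding span_def using X by auto
  fix B assume B: "B \<in> X"
  have "mat_inner ?P B = (\<Sum>C\<in>X. mat_inner A C / mat_inner C C * mat_inner C B)"
    by (rule mat_inner_lincomb[OF X(1)])
  also have "\<dots> = (\<Sum>C\<in>X. if C = B then mat_inner A B else 0)"
    using orth B by (intro sum.cong) (auto simp: orthogonal_mats_def)
  also have "\<dots> = mat_inner A B" using X B by simp
  finally have "mat_inner ?P B = mat_inner A B" .
  then show "mat_inner (A + (-1) \<cdot>\<^sub>m ?P) B = 0"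
    using mat_inner_add_left[OF A smult_carrier_mat[OF lincomb_carrier[OF X(1)]]]
    by (simp add: mat_inner_smult_left del: smult_carrier_mat)
qed

text \<open>Subtracting from \<open>A \<in> W\<close> its projection onto \<open>span X\<close> leaves an element of \<open>W\<close> that is
  orthogonal to \<open>X\<close>, so it vanishes and \<open>A\<close> is its own projection.\<close>

lemma subspace_subset_span_orthogonal:
  assumes W: "VectorSpace.subspace class_ring W V" and X: "X \<subseteq> W" "finite X" and orth: "orthogonal_mats X"
    and max: "\<And>A. A \<in> W \<Longrightarrow> (\<And>B. B \<in> X \<Longrightarrow> mat_inner A B = 0) \<Longrightarrow> A = 0\<^sub>m nr nc"
  shows "span X = W"
proof
  have sub: "submodule class_ring W V" using W by (rule is_module)
  then have Wc: "W \<subseteq> carrier_mat nr nc" unfolding submodule_def by (auto simp: module_mat_simps)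
  show span: "span X \<subseteq> W" using X(1) sub by (rule span_is_subset)
  show "W \<subseteq> span X"
  proof
    fix A assume A: "A \<in> W"
    obtain P where P: "P \<in> span X"
      "\<And>B. B \<in> X \<Longrightarrow> mat_inner (A + (-1) \<cdot>\<^sub>m P) B = 0"
      using orthogonal_projection[OF subset_trans[OF X(1) Wc] X(2) orth subsetD[OF Wc A]] by blast
    have "(-1) \<cdot>\<^sub>m P \<in> W" using submodule.smult_closed[OF sub, of "-1" P] P span
      by (auto simp: module_mat_simps class_ring_simps)
    then have "A + (-1) \<cdot>\<^sub>m P \<in> W" using submodule.m_closed[OF sub A]
      by (auto simp: module_mat_simps)
    then have 0: "A + (-1) \<cdot>\<^sub>m P = 0\<^sub>m nr nc" using max P by blast
    have c: "A \<in> carrier_mat nr nc" "P \<in> carrier_mat nr nc" using A P Wc span by auto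
    have "A = P"
    proof (rule eq_matI)
      fix i j assume ij: "i < dim_row P" "j < dim_col P"
      have "(A + (-1) \<cdot>\<^sub>m P) $$ (i, j) = 0" using 0 c ij by simp
      then show "A $$ (i, j) = P $$ (i, j)" using c ij by simp
    qed (use c in auto)
    then show "A \<in> span X" using P by simp
  qed
qed

text \<open>The matrix units give the dimension of the whole space, which bounds the size of every orthogonal
  set.\<close>

definition mat_units :: "real mat set" where
  "mat_units = (\<lambda>(i, j). mat nr nc (\<lambda>p. if p = (i, j) then 1 else 0)) ` ({..<nr} \<times> {..<nc})"

lemma mat_inner_unit:
  assumes "A \<in> carrier_mat nr nc" "i < nr" "j < nc"
  shows "mat_inner A (mat nr nc (\<lambda>p. if p = (i, j) then 1 else 0)) = A $$ (i, j)"
proof -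
  have "mat_inner A (mat nr nc (\<lambda>p. if p = (i, j) then 1 else 0)) =
     (\<Sum>k<nr. \<Sum>l<nc. if k = i then (if l = j then A $$ (i, j) else 0) else 0)"
    using assms unfolding mat_inner_def by (intro sum.cong) auto
  also have "\<dots> = (\<Sum>k<nr. if k = i then (\<Sum>l<nc. if l = j then A $$ (i, j) else 0) else 0)"
    by (intro sum.cong) auto
  also have "\<dots> = A $$ (i, j)" using assms by simp
  finally show ?thesis .
qed

lemma subspace_carrier: "VectorSpace.subspace class_ring (carrier_mat nr nc) V"
  by (rule VectorSpace.subspace.intro[OF matrix_vs])
    (unfold_locales, auto simp: module_mat_simps class_ring_simps)

lemma mat_units_basis: "basis mat_units" "finite mat_units" "card mat_units = nr * nc"
proof -
  let ?e = "\<lambda>i j. mat nr nc (\<lambda>p. if p = (i, j) then 1 else 0) :: real mat"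
  have e: "?e i j \<in> carrier_mat nr nc" for i j by simp
  show fin: "finite mat_units" by (simp add: mat_units_def)
  have "inj_on (\<lambda>(i, j). ?e i j) ({..<nr} \<times> {..<nc})"
  proof (rule inj_onI, clarsimp)
    fix i j k l assume *: "i < nr" "j < nc" "k < nr" "l < nc" and "?e i j = ?e k l"
    then have "?e i j $$ (i, j) = ?e k l $$ (i, j)" by simp
    then show "i = k \<and> j = l" using * by (simp split: if_splits)
  qed
  then show "card mat_units = nr * nc" unfolding mat_units_def by (subst card_image) auto
  have c: "mat_units \<subseteq> carrier_mat nr nc" by (auto simp: mat_units_def)
  have orth: "orthogonal_mats mat_units"
    unfolding orthogonal_mats_def mat_units_def by (auto simp: mat_inner_unit[OF e])
  have "span mat_units = carrier_mat nr nc"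
  proof (rule subspace_subset_span_orthogonal[OF subspace_carrier c fin orth])
    fix A :: "real mat" assume A: "A \<in> carrier_mat nr nc"
      and "\<And>B. B \<in> mat_units \<Longrightarrow> mat_inner A B = 0"
    then have "A $$ (i, j) = 0" if "i < nr" "j < nc" for i j
      using that mat_inner_unit[OF A that] by (force simp: mat_units_def)
    then show "A = 0\<^sub>m nr nc" using A by (intro eq_matI) auto
  qed
  then show "basis mat_units"
    unfolding basis_def using orthogonal_mats_lin_indpt[OF c orth] c by simp
qed

lemma fin_dim: "fin_dim"
  using mat_units_basis unfolding fin_dim_def basis_def by auto

lemma dim_mat: "dim = nr * nc"
  using dim_basis mat_units_basis by metis

lemma orthogonal_mats_card_le:
  assumes "X \<subseteq> carrier_mat nr nc" "orthogonal_mats X"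
  shows "finite X" "card X \<le> nr * nc"
  using li_le_dim[OF fin_dim assms(1) orthogonal_mats_lin_indpt[OF assms]] dim_mat by auto

text \<open>A largest orthogonal set between \<open>X\<close> and \<open>W\<close> exists because orthogonal sets have bounded size.
  It spans \<open>W\<close>: a nonzero element of \<open>W\<close> orthogonal to it could be added.\<close>

lemma orthogonal_basis_extend:
  assumes W: "VectorSpace.subspace class_ring W V" and X: "X \<subseteq> W" and orth: "orthogonal_mats X"
  obtains Y where "X \<subseteq> Y" "Y \<subseteq> W" "finite Y" "orthogonal_mats Y" "span Y = W"
proof -
  let ?P = "\<lambda>Y. X \<subseteq> Y \<and> Y \<subseteq> W \<and> orthogonal_mats Y"
  have Wc: "W \<subseteq> carrier_mat nr nc"
    using is_module[OF W] unfolding submodule_def by (auto simp: module_mat_simps)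
  have "\<exists>Y. finite Y \<and> maximal Y ?P"
    by (rule maximal_exists[of _ "nr * nc" X]) (use Wc X orth orthogonal_mats_card_le in auto)
  then obtain Y where Y: "finite Y" "?P Y" "\<And>Z. Z \<supseteq> Y \<Longrightarrow> ?P Z \<Longrightarrow> Z = Y"
    unfolding maximal_def by auto
  have "span Y = W"
  proof (rule subspace_subset_span_orthogonal[OF W])
    fix A assume A: "A \<in> W" "\<And>B. B \<in> Y \<Longrightarrow> mat_inner A B = 0"
    show "A = 0\<^sub>m nr nc"
    proof (rule ccontr)
      assume "A \<noteq> 0\<^sub>m nr nc"
      then have nz: "mat_inner A A \<noteq> 0" using A Wc mat_inner_self_eq_0_iff by blast
      have "mat_inner B A = 0" if "B \<in> Y" for B
        using A(2)[OF that] mat_inner_commute[of A nr nc B] that A(1) Y(2) Wc by auto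
      then have "?P (insert A Y)" using A nz Y(2) unfolding orthogonal_mats_def by auto
      then have "A \<in> Y" using Y(3)[of "insert A Y"] by blast
      then show False using A(2) nz by blast
    qed
  qed (use Y in auto)
  with Y that show thesis by blast
qed

lemma dim_orthogonal_span:
  assumes W: "VectorSpace.subspace class_ring W V" and X: "X \<subseteq> W" "finite X" and orth: "orthogonal_mats X"
    and span: "span X = W"
  shows "vectorspace.dim class_ring (V\<lparr>carrier := W\<rparr>) = card X"
proof -
  interpret W: vectorspace class_ring "V\<lparr>carrier := W\<rparr>" by (rule subspace_is_vs[OF W])
  have sub: "submodule class_ring W V" using W by (rule is_module)
  then have Wc: "W \<subseteq> carrier_mat nr nc" unfolding submodule_def by (auto simp: module_mat_simps)
  have "W.basis X"
    unfolding W.basis_def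
    using span_li_not_depend[OF X(1) sub] span X orthogonal_mats_lin_indpt[OF _ orth] Wc by auto
  then show ?thesis using W.dim_basis X by blast
qed

lemma orthogonal_to_span:
  assumes G: "G \<subseteq> carrier_mat nr nc" and "A \<in> span G" and "\<And>B. B \<in> G \<Longrightarrow> mat_inner B C = 0"
  shows "mat_inner A C = 0"
proof -
  obtain a Y where A: "A = lincomb a Y" and Y: "Y \<subseteq> G"
    using assms(2) unfolding span_def by blast
  have "mat_inner A C = (\<Sum>B\<in>Y. a B * mat_inner B C)"
    unfolding A by (rule mat_inner_lincomb) (use Y G in auto)
  also have "\<dots> = 0" using Y assms(3) by (intro sum.neutral) auto
  finally show ?thesis .
qed

text \<open>Extend an orthogonal basis \<open>X\<close> of the span to an orthogonal basis \<open>Y\<close> of the whole space; the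
  family is \<open>Y - X\<close>.\<close>

lemma orthogonal_complement_family:
  assumes G: "G \<subseteq> carrier_mat nr nc"
  obtains F where "F \<subseteq> carrier_mat nr nc" "orthogonal_mats F"
    "\<And>A B. A \<in> F \<Longrightarrow> B \<in> G \<Longrightarrow> mat_inner B A = 0"
    "card F + vectorspace.dim class_ring (V\<lparr>carrier := span G\<rparr>) = nr * nc"
proof -
  have W: "VectorSpace.subspace class_ring (span G) V" using G by (intro span_is_subspace) auto
  obtain X where X: "X \<subseteq> span G" "finite X" "orthogonal_mats X" "span X = span G"
    using orthogonal_basis_extend[OF W, of "{}"] by (auto simp: orthogonal_mats_def)
  have Xc: "X \<subseteq> carrier_mat nr nc" using X(1) span_is_subset2[OF G] by auto
  obtain Y where Y: "X \<subseteq> Y" "Y \<subseteq> carrier_mat nr nc" "finite Y" "orthogonal_mats Y"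
    "span Y = carrier_mat nr nc"
    using orthogonal_basis_extend[OF subspace_carrier Xc X(3)] by auto
  have "basis Y" unfolding basis_def using Y orthogonal_mats_lin_indpt by auto
  then have cardY: "card Y = nr * nc" using dim_basis[of Y] Y dim_mat by auto
  show thesis
  proof
    show "Y - X \<subseteq> carrier_mat nr nc" "orthogonal_mats (Y - X)"
      using Y by (auto simp: orthogonal_mats_def)
    show "mat_inner B A = 0" if "A \<in> Y - X" "B \<in> G" for A B
    proof (rule orthogonal_to_span[OF Xc])
      show "B \<in> span X" using in_own_span[OF G] that X(4) by auto
      show "mat_inner C A = 0" if "C \<in> X" for C
      proof -
        have "C \<in> Y" "A \<in> Y" "C \<noteq> A" using that \<open>A \<in> Y - X\<close> Y(1) by auto
        then show ?thesis using orthogonal_mats_inner[OF Y(4)] by simp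
      qed
    qed
    show "card (Y - X) + vectorspace.dim class_ring (V\<lparr>carrier := span G\<rparr>) = nr * nc"
      using dim_orthogonal_span[OF W X] cardY Y X card_mono[OF Y(3,1)]
      by (simp add: card_Diff_subset)
  qed
qed

text \<open>Together with an orthogonal basis of the span, \<open>F\<close> is still an orthogonal set, so it is subject to
  the bound by the dimension of the whole space.\<close>

lemma card_orthogonal_complement_le:
  assumes G: "G \<subseteq> carrier_mat nr nc" and F: "F \<subseteq> carrier_mat nr nc" "orthogonal_mats F"
    and perp: "\<And>A B. A \<in> F \<Longrightarrow> B \<in> G \<Longrightarrow> mat_inner B A = 0"
  shows "card F + vectorspace.dim class_ring (V\<lparr>carrier := span G\<rparr>) \<le> nr * nc"
proof -
  have W: "VectorSpace.subspace class_ring (span G) V" using G by (intro span_is_subspace) auto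
  obtain X where X: "X \<subseteq> span G" "finite X" "orthogonal_mats X" "span X = span G"
    using orthogonal_basis_extend[OF W, of "{}"] by (auto simp: orthogonal_mats_def)
  have Xc: "X \<subseteq> carrier_mat nr nc" using X(1) span_is_subset2[OF G] by auto
  have 0: "mat_inner B A = 0" "mat_inner A B = 0" if "A \<in> F" "B \<in> X" for A B
  proof -
    show "mat_inner B A = 0" using orthogonal_to_span[OF G] perp that X by blast
    then show "mat_inner A B = 0" using mat_inner_commute[of A nr nc B] that F Xc by auto
  qed
  have "orthogonal_mats (F \<union> X)"
    using F X(3) 0 unfolding orthogonal_mats_def by auto
  moreover have "F \<inter> X = {}" using 0 F(2) unfolding orthogonal_mats_def by blast
  ultimately have "card F + card X \<le> nr * nc"
    using orthogonal_mats_card_le[of "F \<union> X"] orthogonal_mats_card_le[OF F] F Xc X(2)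
    by (simp add: card_Un_disjoint)
  then show ?thesis using dim_orthogonal_span[OF W X] by simp
qed

end

section \<open>The orthogonal complement behind the defect\<close>

text \<open>By \<open>defect_perp_iff\<close> below, this is the orthogonal complement of the matrices whose span defines
  the defect. The condition is complex, which merges the real and imaginary parts, and it ranges
  over all \<open>i\<close> and \<open>j\<close>, so that it splits over product indices with no case distinction on their
  order.\<close>

definition defect_perp :: "complex mat \<Rightarrow> real mat set" where
  "defect_perp U = {R \<in> carrier_mat (dim_row U) (dim_row U).
     \<forall>i<dim_row U. \<forall>j<dim_row U.
       (\<Sum>c<dim_row U. of_real (R $$ (i, c)) * (U $$ (i, c) * cnj (U $$ (j, c)))) =
       (\<Sum>c<dim_row U. of_real (R $$ (j, c)) * (U $$ (i, c) * cnj (U $$ (j, c))))}"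

lemma defect_perp_carrier: "R \<in> defect_perp U \<Longrightarrow> R \<in> carrier_mat (dim_row U) (dim_row U)"
  by (simp add: defect_perp_def)

lemma Re_of_real_mult: "Re (of_real x * z) = x * Re z" and Im_of_real_mult: "Im (of_real x * z) = x * Im z"
  by simp_all

text \<open>Only rows \<open>i\<close> and \<open>j\<close> of the matrix are nonzero, and they are opposite to each other.\<close>

lemma mat_inner_defect_mat:
  assumes R: "R \<in> carrier_mat (dim_row U) (dim_row U)" and "i < j" "j < dim_row U"
  defines "z \<equiv> (\<Sum>c<dim_row U. of_real (R $$ (i, c)) * (U $$ (i, c) * cnj (U $$ (j, c)))) -
       (\<Sum>c<dim_row U. of_real (R $$ (j, c)) * (U $$ (i, c) * cnj (U $$ (j, c))))"
  shows "mat_inner (defect_mat_re U i j) R = Re z" "mat_inner (defect_mat_im U i j) R = Im z"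
proof -
  let ?N = "dim_row U"
  let ?w = "\<lambda>c. U $$ (i, c) * cnj (U $$ (j, c))"
  \<comment> \<open>Only oddness of \<open>Re\<close> and \<open>Im\<close> matters here, so both are handled at once.\<close>
  have key: "mat_inner (map_mat f (defect_mat U i j)) R =
      (\<Sum>c<?N. R $$ (i, c) * f (?w c)) - (\<Sum>c<?N. R $$ (j, c) * f (?w c))"
    if f: "f 0 = 0" "\<And>x. f (- x) = - f x" for f :: "complex \<Rightarrow> real"
  proof -
    have "mat_inner (map_mat f (defect_mat U i j)) R =
       (\<Sum>k<?N. (if k = i then (\<Sum>c<?N. R $$ (i, c) * f (?w c)) else 0) -
               (if k = j then (\<Sum>c<?N. R $$ (j, c) * f (?w c)) else 0))"
      unfolding mat_inner_def using assms(2,3) f(1)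
      by (intro sum.cong) (auto simp: defect_mat_def f(2) sum_negf mult.commute[of "f _"])
    then show ?thesis using assms(2,3) by (simp add: sum_subtractf)
  qed
  show "mat_inner (defect_mat_re U i j) R = Re z" "mat_inner (defect_mat_im U i j) R = Im z"
    unfolding defect_mat_re_def defect_mat_im_def z_def
    using key[of Re] key[of Im]
    by (simp_all only: minus_complex.sel Re_sum Im_sum Re_of_real_mult Im_of_real_mult
        zero_complex.sel uminus_complex.sel refl)
qed

definition defect_generators :: "complex mat \<Rightarrow> real mat set" where
  "defect_generators U = {defect_mat_re U i j | i j. i < j \<and> j < dim_row U} \<union>
      {defect_mat_im U i j | i j. i < j \<and> j < dim_row U}"

lemma defect_generators_carrier: "defect_generators U \<subseteq> carrier_mat (dim_row U) (dim_row U)"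
  by (auto simp: defect_generators_def defect_mat_re_def defect_mat_im_def defect_mat_def)

text \<open>The condition for \<open>(j, i)\<close> is the complex conjugate of the one for \<open>(i, j)\<close>, and the one for
  \<open>(i, i)\<close> is trivial; so the pairs with \<open>i < j\<close> suffice.\<close>

lemma defect_perp_iff:
  assumes R: "R \<in> carrier_mat (dim_row U) (dim_row U)"
  shows "R \<in> defect_perp U \<longleftrightarrow> (\<forall>B\<in>defect_generators U. mat_inner B R = 0)"
proof -
  define s where "s k i j =
    (\<Sum>c<dim_row U. of_real (R $$ (k, c)) * (U $$ (i, c) * cnj (U $$ (j, c))))" for k i j
  have perp: "R \<in> defect_perp U \<longleftrightarrow> (\<forall>i<dim_row U. \<forall>j<dim_row U. s i i j = s j i j)"
    using R by (simp add: defect_perp_def s_def)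
  have inner: "mat_inner (defect_mat_re U i j) R = Re (s i i j - s j i j)"
    "mat_inner (defect_mat_im U i j) R = Im (s i i j - s j i j)" if "i < j" "j < dim_row U" for i j
    using mat_inner_defect_mat[OF R that] unfolding s_def by blast+
  have gens: "(\<forall>B\<in>defect_generators U. mat_inner B R = 0) \<longleftrightarrow>
      (\<forall>i j. i < j \<longrightarrow> j < dim_row U \<longrightarrow> s i i j = s j i j)"
  proof (intro iffI allI impI ballI)
    fix i j assume *: "\<forall>B\<in>defect_generators U. mat_inner B R = 0" "i < j" "j < dim_row U"
    have "defect_mat_re U i j \<in> defect_generators U" "defect_mat_im U i j \<in> defect_generators U"
      using * unfolding defect_generators_def by blast+
    then have "Re (s i i j - s j i j) = 0" "Im (s i i j - s j i j) = 0"
      using *(1) unfolding inner[OF *(2,3), symmetric] by blast+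
    then show "s i i j = s j i j" by (simp add: complex_eq_iff)
  next
    fix B assume *: "\<forall>i j. i < j \<longrightarrow> j < dim_row U \<longrightarrow> s i i j = s j i j"
      and "B \<in> defect_generators U"
    then obtain i j where "i < j" "j < dim_row U" "B = defect_mat_re U i j \<or> B = defect_mat_im U i j"
      unfolding defect_generators_def by blast
    moreover from this * have "s i i j = s j i j" by blast
    ultimately show "mat_inner B R = 0" using inner[of i j] by auto
  qed
  have sym: "s i i j = s j i j \<longleftrightarrow> s j j i = s i j i" for i j
  proof -
    have "cnj (s k i j) = s k j i" for k
      unfolding s_def by (simp add: mult.commute)
    then have "s j j i = cnj (s j i j)" "s i j i = cnj (s i i j)" by simp_all
    then show ?thesis by auto
  qed
  have "s i i j = s j i j"
    if *: "\<forall>i j. i < j \<longrightarrow> j < dim_row U \<longrightarrow> s i i j = s j i j" and "i < dim_row U" "j < dim_row U" for i j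
  proof (cases i j rule: linorder_cases)
    case greater
    then have "s j j i = s i j i" using that by blast
    then show ?thesis using sym[of i j] by simp
  qed (use that in blast)+
  moreover have "i < dim_row U" if "i < j" "j < dim_row U" for i j using that by simp
  ultimately show ?thesis unfolding perp gens by blast
qed

lemma generalized_defect_eq:
  "generalized_defect U = int ((dim_row U)\<^sup>2) - int (vectorspace.dim (class_ring :: real ring)
     ((module_mat TYPE(real) (dim_row U) (dim_row U)) \<lparr>carrier :=
       LinearCombinations.module.span class_ring (module_mat TYPE(real) (dim_row U) (dim_row U))
         (defect_generators U)\<rparr>))"
  unfolding generalized_defect_def defect_span_def defect_generators_def by (rule refl)

lemma defect_perp_orthogonal_basis:
  obtains F where "F \<subseteq> defect_perp U" "orthogonal_mats F" "generalized_defect U = int (card F)"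
proof -
  interpret real_mat_space "dim_row U" "dim_row U" .
  obtain F where F: "F \<subseteq> carrier_mat (dim_row U) (dim_row U)" "orthogonal_mats F"
    "\<And>A B. A \<in> F \<Longrightarrow> B \<in> defect_generators U \<Longrightarrow> mat_inner B A = 0"
    "card F + vectorspace.dim class_ring (V\<lparr>carrier := span (defect_generators U)\<rparr>)
      = dim_row U * dim_row U"
    using orthogonal_complement_family[OF defect_generators_carrier] by blast
  show thesis
  proof
    show "F \<subseteq> defect_perp U" using F(1,3) defect_perp_iff by blast
    show "generalized_defect U = int (card F)"
      unfolding generalized_defect_eq power2_eq_square F(4)[symmetric] by simp
  qed fact
qed

lemma card_le_generalized_defect:
  assumes "F \<subseteq> defect_perp U" "orthogonal_mats F"
  shows "int (card F) \<le> generalized_defect U"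
proof -
  interpret real_mat_space "dim_row U" "dim_row U" .
  have Fc: "F \<subseteq> carrier_mat (dim_row U) (dim_row U)" using assms by (auto simp: defect_perp_def)
  then have "mat_inner B A = 0" if "A \<in> F" "B \<in> defect_generators U" for A B
    using that assms(1) defect_perp_iff by blast
  from card_orthogonal_complement_le[OF defect_generators_carrier Fc assms(2) this]
  show ?thesis unfolding generalized_defect_eq power2_eq_square by linarith
qed

section \<open>Kronecker products\<close>

lemma sum_div_mod:
  fixes f :: "nat \<Rightarrow> nat \<Rightarrow> 'a::comm_monoid_add"
  shows "(\<Sum>k<m * n. f (k div n) (k mod n)) = (\<Sum>a<m. \<Sum>b<n. f a b)"
proof -
  have "(\<Sum>a<m. \<Sum>b<n. f a b) = (\<Sum>(a, b)\<in>{..<m} \<times> {..<n}. f a b)"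
    by (rule sum.cartesian_product)
  also have "\<dots> = (\<Sum>k<m * n. f (k div n) (k mod n))"
  proof (rule sum.reindex_bij_witness[of _ "\<lambda>k. (k div n, k mod n)" "\<lambda>(a, b). a * n + b"])
    fix p assume "p \<in> {..<m} \<times> {..<n}"
    then obtain a b where p: "p = (a, b)" "a < m" "b < n" by auto
    have "a * n + b < Suc a * n" using p by simp
    also have "\<dots> \<le> m * n" using p by (intro mult_right_mono) auto
    finally show "(case p of (a, b) \<Rightarrow> a * n + b) \<in> {..<m * n}" using p by simp
  next
    fix k assume "k \<in> {..<m * n}"
    then show "(k div n, k mod n) \<in> {..<m} \<times> {..<n}"
      by (cases "n = 0") (auto simp: less_mult_imp_div_less)
  qed auto
  finally show ?thesis by simp
qed

lemma sum_div_mod_product: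
  fixes f g :: "nat \<Rightarrow> 'a::semiring_0"
  shows "(\<Sum>k<m * n. f (k div n) * g (k mod n)) = (\<Sum>a<m. f a) * (\<Sum>b<n. g b)"
  unfolding sum_product by (rule sum_div_mod)

text \<open>The same construction as \<open>kron_mat\<close>, which is typed for complex matrices.\<close>

definition real_kron :: "real mat \<Rightarrow> real mat \<Rightarrow> real mat" where
  "real_kron A B = mat (dim_row A * dim_row B) (dim_col A * dim_col B)
     (\<lambda>(i, j). A $$ (i div dim_row B, j div dim_col B) * B $$ (i mod dim_row B, j mod dim_col B))"

lemma mat_inner_real_kron:
  assumes "A \<in> carrier_mat m m'" "A' \<in> carrier_mat m m'"
    and "B \<in> carrier_mat n n'" "B' \<in> carrier_mat n n'"
  shows "mat_inner (real_kron A B) (real_kron A' B') = mat_inner A A' * mat_inner B B'"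
proof -
  have "mat_inner (real_kron A B) (real_kron A' B') =
    (\<Sum>i<m * n. \<Sum>j<m' * n'.
      (A $$ (i div n, j div n') * A' $$ (i div n, j div n')) *
      (B $$ (i mod n, j mod n') * B' $$ (i mod n, j mod n')))"
    using assms by (simp add: mat_inner_def real_kron_def mult.assoc mult.left_commute)
  also have "\<dots> = (\<Sum>i<m * n. (\<Sum>j<m'. A $$ (i div n, j) * A' $$ (i div n, j)) *
                             (\<Sum>j<n'. B $$ (i mod n, j) * B' $$ (i mod n, j)))"
    by (subst sum_div_mod_product[symmetric]) simp
  also have "\<dots> = mat_inner A A' * mat_inner B B'"
    using assms by (subst sum_div_mod_product) (simp add: mat_inner_def)
  finally show ?thesis .
qed

lemma real_kron_in_defect_perp:
  assumes U: "square_mat U" "R \<in> defect_perp U" and V: "square_mat V" "S \<in> defect_perp V"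
  shows "real_kron R S \<in> defect_perp (kron_mat U V)"
proof -
  define M where "M = dim_row U"
  define N where "N = dim_row V"
  have dims: "dim_row U = M" "dim_col U = M" "dim_row V = N" "dim_col V = N"
    using U V by (simp_all add: M_def N_def)
  have RS: "R \<in> carrier_mat M M" "S \<in> carrier_mat N N"
    using U V by (auto simp: defect_perp_def dims)
  \<comment> \<open>Row \<open>k\<close> of \<open>R \<otimes> S\<close> is weighted by the products of the rows \<open>i\<close> and \<open>j\<close> of \<open>U \<otimes> V\<close>;
    for \<open>k = i\<close> and \<open>k = j\<close> these are the two sides of the condition.\<close>
  have factor: "(\<Sum>c<M * N. of_real (real_kron R S $$ (k, c)) *
        (kron_mat U V $$ (i, c) * cnj (kron_mat U V $$ (j, c)))) =
      (\<Sum>c<M. of_real (R $$ (k div N, c)) * (U $$ (i div N, c) * cnj (U $$ (j div N, c)))) *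
      (\<Sum>c<N. of_real (S $$ (k mod N, c)) * (V $$ (i mod N, c) * cnj (V $$ (j mod N, c))))"
    if "i < M * N" "j < M * N" "k < M * N" for i j k
    using that RS by (subst sum_div_mod_product[symmetric])
      (intro sum.cong, auto simp: real_kron_def kron_mat_def dims mult_ac)
  have bound: "i div N < M" "i mod N < N" if "i < M * N" for i
    using that by (cases "N = 0"; auto simp: less_mult_imp_div_less)+
  have perp: "(\<Sum>c<M. of_real (R $$ (i, c)) * (U $$ (i, c) * cnj (U $$ (j, c)))) =
      (\<Sum>c<M. of_real (R $$ (j, c)) * (U $$ (i, c) * cnj (U $$ (j, c))))"
    if "i < M" "j < M" for i j
    using U(2) that unfolding defect_perp_def dims by blast
  have perp': "(\<Sum>c<N. of_real (S $$ (i, c)) * (V $$ (i, c) * cnj (V $$ (j, c)))) =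
      (\<Sum>c<N. of_real (S $$ (j, c)) * (V $$ (i, c) * cnj (V $$ (j, c))))"
    if "i < N" "j < N" for i j
    using V(2) that unfolding defect_perp_def dims by blast
  have row_eq: "(\<Sum>c<M * N. of_real (real_kron R S $$ (i, c)) *
        (kron_mat U V $$ (i, c) * cnj (kron_mat U V $$ (j, c)))) =
      (\<Sum>c<M * N. of_real (real_kron R S $$ (j, c)) *
        (kron_mat U V $$ (i, c) * cnj (kron_mat U V $$ (j, c))))"
    if "i < M * N" "j < M * N" for i j
    unfolding factor[OF that that(1)] factor[OF that that(2)]
    by (rule arg_cong2[of _ _ _ _ "(*)", OF perp perp']; rule bound; fact)
  have dim: "dim_row (kron_mat U V) = M * N" by (simp add: kron_mat_def dims)
  have "real_kron R S \<in> carrier_mat (M * N) (M * N)" using RS by (simp add: real_kron_def)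
  then show ?thesis unfolding defect_perp_def dim using row_eq by blast
qed

section \<open>Supermultiplicativity of the generalized defect\<close>

text \<open>The Kronecker products of two orthogonal bases form an orthogonal family, and distinct pairs give
  distinct products, since the inner product of two products is the product of the inner products.\<close>

lemma generalized_defect_kron_mat:
  assumes U: "square_mat U" and V: "square_mat V"
  shows "generalized_defect U * generalized_defect V \<le> generalized_defect (kron_mat U V)"
proof -
  obtain F where F: "F \<subseteq> defect_perp U" "orthogonal_mats F" "generalized_defect U = int (card F)"
    by (rule defect_perp_orthogonal_basis)
  obtain G where G: "G \<subseteq> defect_perp V" "orthogonal_mats G" "generalized_defect V = int (card G)"
    by (rule defect_perp_orthogonal_basis)
  let ?K = "(\<lambda>(R, S). real_kron R S) ` (F \<times> G)"
  have inner: "mat_inner (real_kron R S) (real_kron R' S') = mat_inner R R' * mat_inner S S'"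
    if "R \<in> F" "R' \<in> F" "S \<in> G" "S' \<in> G" for R R' S S'
    using that F(1) G(1)
    by (intro mat_inner_real_kron[of _ "dim_row U" "dim_row U" _ _ "dim_row V" "dim_row V"])
      (auto dest: defect_perp_carrier)
  have "inj_on (\<lambda>(R, S). real_kron R S) (F \<times> G)"
  proof (rule inj_onI, clarsimp)
    fix R S R' S'
    assume *: "R \<in> F" "S \<in> G" "R' \<in> F" "S' \<in> G" and eq: "real_kron R S = real_kron R' S'"
    have "mat_inner R R' * mat_inner S S' = mat_inner R R * mat_inner S S"
      using inner[OF *(1,3,2,4)] inner[OF *(1,1,2,2)] eq by simp
    also have "\<dots> \<noteq> 0" using * F(2) G(2) by (simp add: orthogonal_mats_def)
    finally show "R = R' \<and> S = S'" using * F(2) G(2) unfolding orthogonal_mats_def by auto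
  qed
  then have "card ?K = card F * card G" by (simp add: card_image card_cartesian_product)
  moreover have "orthogonal_mats ?K"
    unfolding orthogonal_mats_def
  proof (intro conjI ballI impI)
    fix A assume "A \<in> ?K"
    then obtain R S where A: "A = real_kron R S" "R \<in> F" "S \<in> G" by auto
    then show "mat_inner A A \<noteq> 0" using F(2) G(2) by (simp add: inner orthogonal_mats_def)
    fix B assume "B \<in> ?K" and ne: "A \<noteq> B"
    then obtain R' S' where B: "B = real_kron R' S'" "R' \<in> F" "S' \<in> G" by auto
    from ne consider "R \<noteq> R'" | "S \<noteq> S'" using A B by blast
    then show "mat_inner A B = 0"
      using A B F(2) G(2) by cases (simp_all add: inner orthogonal_mats_def)
  qed
  moreover have "?K \<subseteq> defect_perp (kron_mat U V)"
    using F(1) G(1) real_kron_in_defect_perp[OF U _ V] by auto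
  ultimately show ?thesis
    using card_le_generalized_defect[of ?K "kron_mat U V"] F(3) G(3) by simp
qed

lemma generalized_defect_nonneg: "generalized_defect U \<ge> 0"
proof -
  obtain F where "F \<subseteq> defect_perp U" "orthogonal_mats F" "generalized_defect U = int (card F)"
    by (rule defect_perp_orthogonal_basis)
  then show ?thesis by simp
qed

text \<open>Base case of the induction: the identity is an orthogonal family by itself.\<close>

lemma generalized_defect_one: "generalized_defect (1\<^sub>m 1) \<ge> 1"
proof -
  have "{1\<^sub>m 1} \<subseteq> defect_perp (1\<^sub>m 1)" by (auto simp: defect_perp_def)
  moreover have "orthogonal_mats {1\<^sub>m 1}" by (auto simp: orthogonal_mats_def mat_inner_def)
  ultimately show ?thesis using card_le_generalized_defect[of "{1\<^sub>m 1}" "1\<^sub>m 1"] by simp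
qed

lemma square_mat_kron_list:
  assumes "\<And>A. A \<in> set As \<Longrightarrow> square_mat A"
  shows "square_mat (kron_list As)"
  using assms
proof (induction As)
  case (Cons A As)
  then have "square_mat A" "square_mat (kron_list As)" by simp_all
  then show ?case by (simp add: kron_list_def kron_mat_def)
qed (simp add: kron_list_def)

lemma generalized_defect_kron_list:
  assumes "\<And>A. A \<in> set As \<Longrightarrow> square_mat A"
  shows "prod_list (map generalized_defect As) \<le> generalized_defect (kron_list As)"
  using assms
proof (induction As)
  case Nil
  then show ?case using generalized_defect_one by (simp add: kron_list_def)
next
  case (Cons A As)
  have "prod_list (map generalized_defect (A # As)) \<le>
      generalized_defect A * generalized_defect (kron_list As)"
    using Cons generalized_defect_nonneg by (simp add: mult_left_mono)
  also have "\<dots> \<le> generalized_defect (kron_mat A (kron_list As))"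
    using Cons.prems by (intro generalized_defect_kron_mat square_mat_kron_list) auto
  finally show ?case by (simp add: kron_list_def)
qed

theorem corollary3p6:
  fixes r :: nat and n :: "nat \<Rightarrow> nat" and U :: "nat \<Rightarrow> complex mat"
  assumes "r \<ge> 1"
    and "\<And>k. k \<in> {1..r} \<Longrightarrow> U k \<in> carrier_mat (n k) (n k)"
    and "\<And>k. k \<in> {1..r} \<Longrightarrow> unitary_mat (U k)"
  shows "generalized_defect (kron_list (map U [1..<r + 1])) \<ge> (\<Prod>k = 1..r. generalized_defect (U k))"
proof -
  have "(\<Prod>k = 1..r. generalized_defect (U k)) =
      (\<Prod>k\<in>set [1..<r + 1]. generalized_defect (U k))"
    by (rule prod.cong) auto
  also have "\<dots> = prod_list (map (\<lambda>k. generalized_defect (U k)) [1..<r + 1])"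
    by (rule prod.distinct_set_conv_list) (rule distinct_upt)
  also have "\<dots> = prod_list (map generalized_defect (map U [1..<r + 1]))"
    unfolding map_map comp_def by (rule refl)
  also have "\<dots> \<le> generalized_defect (kron_list (map U [1..<r + 1]))"
    using assms(3) by (intro generalized_defect_kron_list) (auto simp: unitary_mat_def)
  finally show ?thesis .
qed

end
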